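(* Let $K$ be a field, let $m,n$ be positive integers, let $\alpha$ be a partition of $m$ and let $\beta$ be a partition of $n$. If there exists $A \in M_{m \times n}(K)$ such that $AA^{\top}$ is nilpotent, $\mu(A^{\top}A) = \beta$ and $\mu(AA^{\top}) = \alpha$, then (1) $|\alpha_i - \beta_i| \le 1$ for all $i$; and (2) every component of $\gamma(\alpha,\beta)$ not involving $1$ (i.e. not having $1$ as one of its parts) has even length.
   Context: For a nilpotent square matrix $N$ of size $n$, $\mu(N) = (\mu_1 \ge \mu_2 \ge \cdots)$ is the partition of $n$ given by the sizes of the Jordan blocks of $N$. Partitions are written in non-increasing order and parts equal to $0$ are allowed, i.e. partitions are padded by zeros so that $\alpha_i, \beta_i$ make sense for all $i\geq 1$. $\gamma(\alpha,\beta)$ is the partition whose parts are the $\alpha_i$ for those indices $i$ with $\alpha_i = \beta_i > 0$ (one part for each such index $i$). If $\lambda = (\lambda_1 \ge \cdots \ge \lambda_r > 0)$ is a partition, a component of $\lambda$ is a maximal consecutive subsequence of the parts of $\lambda$ such that the difference of any two consecutive terms is at most $1$; its length is its number of parts. *)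

theory Defs
  imports "Jordan_Normal_Form.Jordan_Normal_Form_Uniqueness"
begin

text \<open>A partition is the list of its nonzero parts in non-increasing order; the
  padding by zeros is supplied by \<open>part\<close>. Indices start at 0, so \<open>part \<alpha> i\<close> is
  $\alpha_{i+1}$ of the usual notation.\<close>

definition is_partition_of :: "nat list \<Rightarrow> nat \<Rightarrow> bool" where
  "is_partition_of \<alpha> n \<longleftrightarrow> sorted_wrt (\<ge>) \<alpha> \<and> 0 \<notin> set \<alpha> \<and> sum_list \<alpha> = n"

definition part :: "nat list \<Rightarrow> nat \<Rightarrow> nat" where
  "part \<alpha> i = (if i < length \<alpha> then \<alpha> ! i else 0)"

definition nilpotent_mat :: "'a :: semiring_1 mat \<Rightarrow> bool" where
  "nilpotent_mat N \<longleftrightarrow> square_mat N \<and> (\<exists>k. N ^\<^sub>m k = 0\<^sub>m (dim_row N) (dim_row N))"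

text \<open>\<open>has_jordan_partition N p\<close> says that \<open>N\<close> is nilpotent with $\mu(N) = p$. It is a
  relation because the library's Jordan normal form is one; the lemma
  \<open>has_jordan_partition_unique\<close> justifies reading it as an equation. The blocks in
  \<open>jordan_nf\<close> come in an arbitrary order and have positive size; all eigenvalues of a
  nilpotent matrix are 0, so its Jordan form exists over any field.\<close>

definition has_jordan_partition :: "'a :: field mat \<Rightarrow> nat list \<Rightarrow> bool" where
  "has_jordan_partition N p \<longleftrightarrow>
     (\<exists>n_as. jordan_nf N n_as \<and> (\<forall>(k, a) \<in> set n_as. a = 0) \<and> p = rev (sort (map fst n_as)))"

lemma has_jordan_partition_unique:
  assumes "has_jordan_partition N p" "has_jordan_partition N q"
  shows "p = q"
proof -
  have key: "count (mset (map fst xs)) k = (if k = 0 then 0 else compute_nr_of_jordan_blocks N 0 k)"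
    if "jordan_nf N xs" and ev: "\<forall>(k, a) \<in> set xs. a = 0" for xs k
  proof (cases "k = 0")
    case True
    with that show ?thesis by (auto simp: jordan_nf_def count_eq_zero_iff)
  next
    case False
    have "count (mset (map fst xs)) k = length (filter ((=) (k, 0)) xs)"
      using ev by (induction xs) auto
    with False compute_nr_of_jordan_blocks[OF that(1) False, of 0] show ?thesis by simp
  qed
  from assms obtain xs ys where
    "jordan_nf N xs" "\<forall>(k, a) \<in> set xs. a = 0" "p = rev (sort (map fst xs))"
    "jordan_nf N ys" "\<forall>(k, a) \<in> set ys. a = 0" "q = rev (sort (map fst ys))"
    unfolding has_jordan_partition_def by blast
  moreover from this have "mset (map fst xs) = mset (map fst ys)"
    by (intro multiset_eqI) (simp only: key)
  ultimately show ?thesis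
    by (metis properties_for_sort mset_sort sorted_sort)
qed

definition gamma :: "nat list \<Rightarrow> nat list \<Rightarrow> nat list" where
  "gamma \<alpha> \<beta> = map (part \<alpha>) (filter (\<lambda>i. part \<alpha> i = part \<beta> i \<and> part \<alpha> i > 0) [0..<length \<alpha>])"

definition small_gaps :: "nat list \<Rightarrow> bool" where
  "small_gaps c \<longleftrightarrow> successively (\<lambda>a b. \<bar>int a - int b\<bar> \<le> 1) c"

text \<open>Maximality refers to the position of \<open>c\<close> in \<open>p\<close>: the occurrence of \<open>c\<close> between
  \<open>xs\<close> and \<open>ys\<close> cannot be extended to either side.\<close>

definition is_component :: "nat list \<Rightarrow> nat list \<Rightarrow> bool" where
  "is_component p c \<longleftrightarrow> c \<noteq> [] \<and> small_gaps c \<and>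
     (\<exists>xs ys. p = xs @ c @ ys \<and>
        (\<forall>xs1 xs2 ys1 ys2. xs = xs1 @ xs2 \<and> ys = ys1 @ ys2 \<and> small_gaps (xs2 @ c @ ys1)
           \<longrightarrow> xs2 = [] \<and> ys1 = []))"

end

theory Submission
  imports Defs
begin

text \<open>The proof sees \<open>A\<close> only through the ranks of alternating products of \<open>A\<close> and \<open>A\<^sup>T\<close>.
  Put
  \<open>p k = rank ((A A\<^sup>T)^k)\<close>, \<open>p' k = rank ((A\<^sup>T A)^k)\<close> and \<open>q k = rank (A (A\<^sup>T A)^k)\<close>.
  Consecutive differences of \<open>p\<close> and of \<open>p'\<close> count the Jordan blocks above a given size
  (\<open>jordan_partition_parts_rank\<close>), so \<open>p\<close> and \<open>p'\<close> determine \<open>\<alpha>\<close> and \<open>\<beta>\<close>.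

  The symmetry of the situation enters at one point: the products of odd length
  \<open>A (A\<^sup>T A)^k\<close> and \<open>A\<^sup>T (A A\<^sup>T)^k\<close> are transposes of each other and hence have the same
  rank (\<open>mat_rank_odd_word_symmetric\<close>). For arbitrary pairs of matrices there would be two
  sequences of odd ranks, and only the bound on \<open>\<alpha>_i - \<beta>_i\<close> would survive.

  Frobenius' inequality (\<open>frobenius_rank_inequality\<close>) now makes the numbers
  \<open>a k = p k + p' (k+1) - 2 q k\<close>, \<open>b k = p' k + p (k+1) - 2 q k\<close> and
  \<open>e k = q k + q (k+1) - p (k+1) - p' (k+1)\<close>
  nonnegative. They are the multiplicities in a decomposition of the pair into alternating
  chains of basis vectors: \<open>a k\<close> chains with \<open>k+1\<close> vectors on the side of \<open>\<alpha>\<close> and \<open>k\<close> on the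
  side of \<open>\<beta>\<close>, \<open>b k\<close> chains of the opposite shape, and \<open>e k\<close> chains with \<open>k+1\<close> vectors on
  either side for each of the two possible starting sides. The decomposition itself is not
  constructed; its numerical consequences suffice.

  The number of parts of \<open>\<gamma>(\<alpha>,\<beta>)\<close> equal to \<open>k+1\<close> comes out as
  \<open>2 e k + min (a k) (b k) + min (a (k+1)) (b (k+1))\<close>. Summed over a component with values
  from \<open>s+1\<close> to \<open>t+1\<close>, every minimum other than those at \<open>s\<close> and \<open>t+1\<close> occurs twice. If
  \<open>s > 0\<close>, then \<open>s\<close> and \<open>t+2\<close> are positive values missing from \<open>\<gamma>(\<alpha>,\<beta>)\<close>, which forces the
  two outer minima to vanish, and the length is even
  (\<open>component_length_even\<close>).\<close>

section \<open>Rank of a matrix and rank factorizations\<close>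

text \<open>The subtraction never truncates, by \<open>rank_nullity\<close> below.\<close>

definition mat_rank :: "'a :: field mat \<Rightarrow> nat" where
  "mat_rank M = dim_col M - kernel_dim M"

text \<open>If \<open>r < n\<close>, padding both factors with zeros to square matrices would give a two-sided
  inverse with a zero row. All lower bounds for ranks below reduce to
  this lemma: an identity matrix is exhibited as a product through a small dimension.\<close>

lemma one_mat_factor_dim:
  fixes P Q :: "'a :: field mat"
  assumes P: "P \<in> carrier_mat n r" and Q: "Q \<in> carrier_mat r n" and PQ: "P * Q = 1\<^sub>m n"
  shows "n \<le> r"
proof (rule ccontr)
  assume "\<not> n \<le> r"
  then have r: "r < n" by simp
  define P' where "P' = mat n n (\<lambda>(i, j). if j < r then P $$ (i, j) else 0)"
  define Q' where "Q' = mat n n (\<lambda>(i, j). if i < r then Q $$ (i, j) else 0)"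
  have carr: "P' \<in> carrier_mat n n" "Q' \<in> carrier_mat n n"
    by (auto simp: P'_def Q'_def)
  have "P' * Q' = P * Q"
  proof (rule eq_matI)
    fix i j assume "i < dim_row (P * Q)" "j < dim_col (P * Q)"
    then have ij: "i < n" "j < n" using P Q by auto
    have "(P' * Q') $$ (i, j) = (\<Sum>k<n. if k < r then P $$ (i, k) * Q $$ (k, j) else 0)"
      using ij by (auto simp: P'_def Q'_def scalar_prod_def lessThan_atLeast0 intro!: sum.cong)
    also have "\<dots> = (\<Sum>k<r. P $$ (i, k) * Q $$ (k, j))"
      using r by (intro sum.mono_neutral_cong_right) auto
    also have "\<dots> = (P * Q) $$ (i, j)"
      using ij P Q by (auto simp: scalar_prod_def lessThan_atLeast0 intro!: sum.cong)
    finally show "(P' * Q') $$ (i, j) = (P * Q) $$ (i, j)" .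
  qed (use carr P Q in auto)
  then have "Q' * P' = 1\<^sub>m n"
    using mat_mult_left_right_inverse[OF carr] PQ by simp
  moreover have "(Q' * P') $$ (n - 1, n - 1) = 0"
    using r by (auto simp: Q'_def P'_def scalar_prod_def intro!: sum.neutral)
  ultimately show False using r by simp
qed

text \<open>Gauss-Jordan elimination writes \<open>M = H C\<close> with \<open>H\<close> invertible and \<open>C\<close> in reduced row
  echelon form. The nonzero rows of \<open>C\<close> form \<open>Q\<close>, and the corresponding columns of \<open>H\<close> form
  \<open>P\<close>. The pivot columns of \<open>C\<close> are unit vectors, so selecting them gives the right inverse
  of \<open>Q\<close>.\<close>

lemma pivot_rank_factorization:
  fixes M :: "'a :: field mat"
  assumes M: "M \<in> carrier_mat nr nc"
  obtains P Q L R r where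
    "kernel_dim M = nc - r"
    "P \<in> carrier_mat nr r" "Q \<in> carrier_mat r nc"
    "L \<in> carrier_mat r nr" "R \<in> carrier_mat nc r"
    "M = P * Q" "L * P = 1\<^sub>m r" "Q * R = 1\<^sub>m r"
proof -
  define C where "C = gauss_jordan_single M"
  note gj = gauss_jordan_single[OF M C_def[symmetric]]
  have C: "C \<in> carrier_mat nr nc" by (rule gj(2))
  from gj(4) obtain G H where CGM: "C = G * M" and G: "G \<in> carrier_mat nr nr"
    and H: "H \<in> carrier_mat nr nr" and GH: "G * H = 1\<^sub>m nr" and HG: "H * G = 1\<^sub>m nr"
    by blast
  from gj(3) C obtain f where f: "pivot_fun C f nc"
    unfolding row_echelon_form_def by auto
  define pl where "pl = pivot_positions C"
  define r where "r = length pl"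
  note pp = pivot_positions[OF C f, folded pl_def]
  have dimC: "dim_row C = nr" using C by simp
  note fD = pivot_funD[OF dimC f]
  have pos: "fst (pl ! k) < nr \<and> snd (pl ! k) = f (fst (pl ! k)) \<and> snd (pl ! k) < nc"
    if "k < r" for k
  proof -
    have "pl ! k \<in> set pl" using that r_def by simp
    then show ?thesis using pp(1) fD(1) by (auto simp: le_neq_implies_less)
  qed
  have inj: "fst (pl ! k) = fst (pl ! l) \<longleftrightarrow> k = l" if "k < r" "l < r" for k l
    using pp(2) that unfolding r_def by (auto simp: distinct_conv_nth)
  \<comment> \<open>Multiplying by \<open>S\<close> on the left selects the pivot rows, by \<open>T\<close> on the right the pivot columns.\<close>
  define S :: "'a mat" where "S = mat r nr (\<lambda>(k, i). if i = fst (pl ! k) then 1 else 0)"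
  define T :: "'a mat" where "T = mat nc r (\<lambda>(j, k). if j = snd (pl ! k) then 1 else 0)"
  have S: "S \<in> carrier_mat r nr" and T: "T \<in> carrier_mat nc r"
    by (auto simp: S_def T_def)
  have St: "S\<^sup>T \<in> carrier_mat nr r" using S by simp
  have SSt: "S * S\<^sup>T = 1\<^sub>m r"
  proof (rule eq_matI)
    fix k l assume "k < dim_row (1\<^sub>m r :: 'a mat)" "l < dim_col (1\<^sub>m r :: 'a mat)"
    then have kl: "k < r" "l < r" by auto
    have "(S * S\<^sup>T) $$ (k, l) = (\<Sum>i<nr. S $$ (k, i) * S $$ (l, i))"
      using kl S by (auto simp: scalar_prod_def lessThan_atLeast0 intro!: sum.cong)
    also have "\<dots> = (\<Sum>i<nr. if i = fst (pl ! k) then (if k = l then 1 else 0) else 0)"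
      using kl inj[of k l] by (intro sum.cong) (auto simp: S_def)
    also have "\<dots> = 1\<^sub>m r $$ (k, l)" using kl pos[of k] by simp
    finally show "(S * S\<^sup>T) $$ (k, l) = 1\<^sub>m r $$ (k, l)" .
  qed (use S in auto)
  have SC: "(S * C) $$ (k, j) = C $$ (fst (pl ! k), j)" if "k < r" "j < nc" for k j
  proof -
    have "(S * C) $$ (k, j) = (\<Sum>i<nr. S $$ (k, i) * C $$ (i, j))"
      using that S C by (auto simp: scalar_prod_def lessThan_atLeast0 intro!: sum.cong)
    also have "\<dots> = (\<Sum>i<nr. if i = fst (pl ! k) then C $$ (fst (pl ! k), j) else 0)"
      using that by (intro sum.cong) (auto simp: S_def)
    finally have "(S * C) $$ (k, j) = \<dots>" .
    then show ?thesis using pos[of k] that by simp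
  qed
  have StSC: "S\<^sup>T * (S * C) = C"
  proof (rule eq_matI)
    fix i j assume "i < dim_row C" "j < dim_col C"
    then have ij: "i < nr" "j < nc" using C by auto
    have "(S\<^sup>T * (S * C)) $$ (i, j) = (\<Sum>k<r. S $$ (k, i) * (S * C) $$ (k, j))"
      using ij S C by (auto simp: scalar_prod_def lessThan_atLeast0 intro!: sum.cong)
    also have "\<dots> = (\<Sum>k<r. if i = fst (pl ! k) then C $$ (i, j) else 0)"
      using ij SC by (intro sum.cong) (auto simp: S_def)
    also have "\<dots> = C $$ (i, j)"
    proof (cases "f i = nc")
      case True
      then have "C $$ (i, j) = 0" using fD(2)[OF ij(1)] ij by simp
      then show ?thesis by (intro trans[OF sum.neutral]) auto
    next
      case False
      then have "(i, f i) \<in> set pl" using pp(1) ij by auto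
      then obtain k0 where k0: "k0 < r" "pl ! k0 = (i, f i)"
        unfolding r_def by (metis in_set_conv_nth)
      have "(\<Sum>k<r. if i = fst (pl ! k) then C $$ (i, j) else 0)
          = (\<Sum>k<r. if k = k0 then C $$ (i, j) else 0)"
        using k0 inj[OF _ k0(1)] by (intro sum.cong) (auto simp: eq_commute)
      then show ?thesis using k0 by simp
    qed
    finally show "(S\<^sup>T * (S * C)) $$ (i, j) = C $$ (i, j)" .
  qed (use S C in auto)
  have CT: "C * T = S\<^sup>T"
  proof (rule eq_matI)
    fix i k assume "i < dim_row S\<^sup>T" "k < dim_col S\<^sup>T"
    then have ik: "i < nr" "k < r" using S by auto
    note p = pos[OF ik(2)]
    have "(C * T) $$ (i, k) = (\<Sum>j<nc. C $$ (i, j) * T $$ (j, k))"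
      using ik C T by (auto simp: scalar_prod_def lessThan_atLeast0 intro!: sum.cong)
    also have "\<dots> = (\<Sum>j<nc. if j = snd (pl ! k) then C $$ (i, snd (pl ! k)) else 0)"
      using ik by (intro sum.cong) (auto simp: T_def)
    also have "\<dots> = C $$ (i, f (fst (pl ! k)))" using p by simp
    also have "\<dots> = S\<^sup>T $$ (i, k)"
      using ik p fD(4,5)[of "fst (pl ! k)"] by (auto simp: S_def)
    finally show "(C * T) $$ (i, k) = S\<^sup>T $$ (i, k)" .
  qed (use S C T in auto)
  show thesis
  proof (rule that[of r "H * S\<^sup>T" "S * C" "S * G" T])
    show "kernel_dim M = nc - r"
      using M kernel_dim_code[of M] by (simp add: r_def pl_def C_def)
    have "H * S\<^sup>T * (S * C) = H * C"
      using assoc_mult_mat[OF H St mult_carrier_mat[OF S C]] StSC by simp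
    also have "\<dots> = M" unfolding CGM using assoc_mult_mat[OF H G M] HG M by simp
    finally show "M = H * S\<^sup>T * (S * C)" by simp
    have "S * G * (H * S\<^sup>T) = S * (G * (H * S\<^sup>T))"
      by (rule assoc_mult_mat[OF S G]) (use H St in auto)
    also have "G * (H * S\<^sup>T) = S\<^sup>T"
      using assoc_mult_mat[OF G H St] GH St by simp
    finally show "S * G * (H * S\<^sup>T) = 1\<^sub>m r" using SSt by simp
    show "S * C * T = 1\<^sub>m r"
      using assoc_mult_mat[OF S C T] CT SSt by simp
  qed (use H S St C T G in auto)
qed

lemma rank_factorization:
  fixes M :: "'a :: field mat"
  assumes M: "M \<in> carrier_mat nr nc"
  obtains P Q L R where
    "P \<in> carrier_mat nr (mat_rank M)" "Q \<in> carrier_mat (mat_rank M) nc"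
    "L \<in> carrier_mat (mat_rank M) nr" "R \<in> carrier_mat nc (mat_rank M)"
    "M = P * Q" "L * P = 1\<^sub>m (mat_rank M)" "Q * R = 1\<^sub>m (mat_rank M)"
proof -
  obtain P Q L R r where *: "kernel_dim M = nc - r"
    "P \<in> carrier_mat nr r" "Q \<in> carrier_mat r nc"
    "L \<in> carrier_mat r nr" "R \<in> carrier_mat nc r"
    "M = P * Q" "L * P = 1\<^sub>m r" "Q * R = 1\<^sub>m r"
    by (rule pivot_rank_factorization[OF M])
  have "r \<le> nc" by (rule one_mat_factor_dim[OF *(3,5,8)])
  then have "r = mat_rank M" using *(1) M by (simp add: mat_rank_def)
  then show thesis using that * by blast
qed

lemma rank_nullity:
  fixes M :: "'a :: field mat"
  assumes M: "M \<in> carrier_mat nr nc"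
  shows "mat_rank M + kernel_dim M = nc"
proof -
  obtain P Q L R r where *: "kernel_dim M = nc - r"
    "P \<in> carrier_mat nr r" "Q \<in> carrier_mat r nc"
    "L \<in> carrier_mat r nr" "R \<in> carrier_mat nc r"
    "M = P * Q" "L * P = 1\<^sub>m r" "Q * R = 1\<^sub>m r"
    by (rule pivot_rank_factorization[OF M])
  have "r \<le> nc" by (rule one_mat_factor_dim[OF *(3,5,8)])
  then show ?thesis using *(1) M by (simp add: mat_rank_def)
qed

text \<open>The lower-bound half of a rank factorization: the identity of size \<open>mat_rank M\<close> factors
  through \<open>M\<close>.\<close>

lemma rank_one_mat_compression:
  fixes M :: "'a :: field mat"
  assumes M: "M \<in> carrier_mat nr nc"
  obtains L R where "L \<in> carrier_mat (mat_rank M) nr" "R \<in> carrier_mat nc (mat_rank M)"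
    "L * M * R = 1\<^sub>m (mat_rank M)"
proof -
  let ?r = "mat_rank M"
  obtain P Q L R where *: "P \<in> carrier_mat nr ?r" "Q \<in> carrier_mat ?r nc"
    "L \<in> carrier_mat ?r nr" "R \<in> carrier_mat nc ?r"
    "M = P * Q" "L * P = 1\<^sub>m ?r" "Q * R = 1\<^sub>m ?r"
    by (rule rank_factorization[OF M])
  have "L * M = Q" using assoc_mult_mat[OF *(3,1,2)] *(2,5,6) by simp
  with *(7) have "L * M * R = 1\<^sub>m ?r" by simp
  then show thesis by (rule that[OF *(3,4)])
qed

text \<open>A rank factorization of \<open>M\<close> transposes to one of \<open>M\<^sup>T\<close> through the same dimension, and the
  identity of size \<open>mat_rank M\<^sup>T\<close> factors through it.\<close>

lemma mat_rank_transpose_le: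
  fixes M :: "'a :: field mat"
  assumes M: "M \<in> carrier_mat nr nc"
  shows "mat_rank M\<^sup>T \<le> mat_rank M"
proof -
  let ?r = "mat_rank M" and ?s = "mat_rank M\<^sup>T"
  obtain P Q where PQ: "P \<in> carrier_mat nr ?r" "Q \<in> carrier_mat ?r nc" "M = P * Q"
    by (rule rank_factorization[OF M])
  have Mt: "M\<^sup>T \<in> carrier_mat nc nr" using M by simp
  obtain L R where LR: "L \<in> carrier_mat ?s nc" "R \<in> carrier_mat nr ?s" "L * M\<^sup>T * R = 1\<^sub>m ?s"
    by (rule rank_one_mat_compression[OF Mt])
  have t: "Q\<^sup>T \<in> carrier_mat nc ?r" "P\<^sup>T \<in> carrier_mat ?r nr" using PQ by auto
  have "M\<^sup>T = Q\<^sup>T * P\<^sup>T" unfolding PQ(3) by (rule transpose_mult[OF PQ(1,2)])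
  then have "(L * Q\<^sup>T) * (P\<^sup>T * R) = L * M\<^sup>T * R"
    using assoc_mult_mat[OF mult_carrier_mat[OF LR(1) t(1)] t(2) LR(2)] assoc_mult_mat[OF LR(1) t]
    by simp
  then have "(L * Q\<^sup>T) * (P\<^sup>T * R) = 1\<^sub>m ?s" using LR by simp
  then show ?thesis
    by (rule one_mat_factor_dim[rotated 2]) (use LR t in auto)
qed

lemma mat_rank_transpose:
  fixes M :: "'a :: field mat"
  shows "mat_rank M\<^sup>T = mat_rank M"
  using mat_rank_transpose_le[of M] mat_rank_transpose_le[of "M\<^sup>T"]
  by (metis carrier_mat_triv le_antisym transpose_transpose)

section \<open>Frobenius' inequality\<close>

lemma assoc_mult_mat4:
  fixes A :: "'a :: semiring_0 mat"
  assumes A: "A \<in> carrier_mat a b" and B: "B \<in> carrier_mat b c"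
    and C: "C \<in> carrier_mat c d" and D: "D \<in> carrier_mat d e"
  shows "A * B * (C * D) = A * (B * C) * D"
proof -
  have "A * B * (C * D) = A * B * C * D"
    using assoc_mult_mat[OF mult_carrier_mat[OF A B] C D] by simp
  also have "A * B * C = A * (B * C)" by (rule assoc_mult_mat[OF A B C])
  finally show ?thesis .
qed

text \<open>The block matrix with rows \<open>(X Y, 0)\<close> and \<open>(Y, Y Z)\<close> is equivalent to the block diagonal
  matrix with blocks \<open>Y\<close> and \<open>- X Y Z\<close>, so it factors through dimension
  \<open>rank Y + rank (X Y Z)\<close>. On the other hand, compressing its two diagonal blocks to
  identity matrices leaves a unitriangular matrix of size \<open>rank (X Y) + rank (Y Z)\<close>. In the
  proof the matrices \<open>F\<close> and \<open>G\<close> are this factorization with the compression already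
  applied, and \<open>I\<close> inverts the unitriangular product.\<close>

lemma frobenius_rank_inequality:
  fixes X Y Z :: "'a :: field mat"
  assumes X: "X \<in> carrier_mat a b" and Y: "Y \<in> carrier_mat b c" and Z: "Z \<in> carrier_mat c d"
  shows "mat_rank (X * Y) + mat_rank (Y * Z) \<le> mat_rank Y + mat_rank (X * Y * Z)"
proof -
  define s t r u where rank_defs: "s = mat_rank (X * Y)" "t = mat_rank (Y * Z)"
    "r = mat_rank Y" "u = mat_rank (X * Y * Z)"
  have XY: "X * Y \<in> carrier_mat a c" and YZ: "Y * Z \<in> carrier_mat b d"
    and XYZ: "X * Y * Z \<in> carrier_mat a d" using X Y Z by auto
  obtain P Q where PQ: "P \<in> carrier_mat b r" "Q \<in> carrier_mat r c" "Y = P * Q"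
    by (rule rank_factorization[OF Y, folded rank_defs])
  obtain P' Q' where PQ': "P' \<in> carrier_mat a u" "Q' \<in> carrier_mat u d" "X * Y * Z = P' * Q'"
    by (rule rank_factorization[OF XYZ, folded rank_defs])
  obtain L1 R1 where LR1: "L1 \<in> carrier_mat s a" "R1 \<in> carrier_mat c s"
    "L1 * (X * Y) * R1 = 1\<^sub>m s"
    by (rule rank_one_mat_compression[OF XY, folded rank_defs])
  obtain L2 R2 where LR2: "L2 \<in> carrier_mat t b" "R2 \<in> carrier_mat d t"
    "L2 * (Y * Z) * R2 = 1\<^sub>m t"
    by (rule rank_one_mat_compression[OF YZ, folded rank_defs])
  define p11 p21 p22 q11 q12 q22 W where
    "p11 = L1 * X * P" and "p21 = L2 * P" and "p22 = - (L1 * P')" and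
    "q11 = Q * R1" and "q12 = Q * (Z * R2)" and "q22 = Q' * R2" and "W = L2 * (P * Q) * R1"
  have c: "p11 \<in> carrier_mat s r" "p21 \<in> carrier_mat t r" "p22 \<in> carrier_mat s u"
    "q11 \<in> carrier_mat r s" "q12 \<in> carrier_mat r t" "q22 \<in> carrier_mat u t"
    "W \<in> carrier_mat t s" "- W \<in> carrier_mat t s"
    using X Y Z PQ(1,2) PQ'(1,2) LR1(1,2) LR2(1,2)
    by (auto simp: p11_def p21_def p22_def q11_def q12_def q22_def W_def)
  let ?F = "four_block_mat p11 p22 p21 (0\<^sub>m t u)"
  let ?G = "four_block_mat q11 q12 (0\<^sub>m u s) q22"
  let ?I = "four_block_mat (1\<^sub>m s) (0\<^sub>m s t) (- W) (1\<^sub>m t)"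
  have F: "?F \<in> carrier_mat (s + t) (r + u)" and G: "?G \<in> carrier_mat (r + u) (s + t)"
    and I: "?I \<in> carrier_mat (s + t) (s + t)" using c by auto
  have L1X: "L1 * X \<in> carrier_mat s b" and ZR2: "Z * R2 \<in> carrier_mat c t"
    using LR1 LR2 X Z by auto
  have e11: "p11 * q11 = 1\<^sub>m s"
    unfolding p11_def q11_def assoc_mult_mat4[OF L1X PQ(1,2) LR1(2)] PQ(3)[symmetric]
      assoc_mult_mat[OF LR1(1) X Y] by (rule LR1(3))
  have e21: "p21 * q11 = W"
    unfolding p21_def q11_def W_def by (rule assoc_mult_mat4[OF LR2(1) PQ(1,2) LR1(2)])
  have e22: "p21 * q12 = 1\<^sub>m t"
    unfolding p21_def q12_def assoc_mult_mat4[OF LR2(1) PQ(1,2) ZR2] PQ(3)[symmetric]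
      assoc_mult_mat4[OF LR2(1) Y Z LR2(2)] by (rule LR2(3))
  have e12: "p11 * q12 + p22 * q22 = 0\<^sub>m s t"
  proof -
    have "p11 * q12 = L1 * X * Y * (Z * R2)"
      unfolding p11_def q12_def assoc_mult_mat4[OF L1X PQ(1,2) ZR2] PQ(3)[symmetric] ..
    also have "\<dots> = L1 * (X * Y) * (Z * R2)"
      unfolding assoc_mult_mat[OF LR1(1) X Y] ..
    also have "\<dots> = L1 * (X * Y * Z) * R2"
      by (rule assoc_mult_mat4[OF LR1(1) XY Z LR2(2)])
    also have "\<dots> = L1 * P' * (Q' * R2)"
      unfolding PQ'(3) by (rule assoc_mult_mat4[OF LR1(1) PQ'(1,2) LR2(2), symmetric])
    finally have 1: "p11 * q12 = L1 * P' * (Q' * R2)" .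
    have "p22 * q22 = - (L1 * P' * (Q' * R2))"
      unfolding p22_def q22_def using PQ'(1,2) LR1(1) LR2(2)
      by (intro uminus_mult_left_mat) auto
    then show ?thesis unfolding 1
      by (auto intro!: eq_matI simp: PQ'(1,2) LR1(1) LR2(2) carrier_matD[OF LR1(1)] carrier_matD[OF LR2(2)])
  qed
  have FG: "?F * ?G = four_block_mat (1\<^sub>m s) (0\<^sub>m s t) W (1\<^sub>m t)"
    unfolding mult_four_block_mat[OF c(1,3,2) zero_carrier_mat c(4,5) zero_carrier_mat c(6)]
      e11 e12 e21 e22 using c(3,6,7) by simp
  have "?I * (?F * ?G) = 1\<^sub>m (s + t)"
    unfolding FG mult_four_block_mat[OF one_carrier_mat zero_carrier_mat c(8) one_carrier_mat
        one_carrier_mat zero_carrier_mat c(7) one_carrier_mat]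
    using c(7,8) by (simp add: uminus_l_inv_mat)
  then have "(?I * ?F) * ?G = 1\<^sub>m (s + t)" using assoc_mult_mat[OF I F G] by simp
  then show ?thesis
    unfolding rank_defs[symmetric] by (rule one_mat_factor_dim[OF mult_carrier_mat[OF I F] G])
qed

section \<open>Ranks of alternating products\<close>

lemma mult_pow_mat_swap:
  fixes X Y :: "'a :: semiring_1 mat"
  assumes X: "X \<in> carrier_mat a b" and Y: "Y \<in> carrier_mat b a"
  shows "(X * Y) ^\<^sub>m k * X = X * (Y * X) ^\<^sub>m k"
proof (induction k)
  case 0
  show ?case using X Y by simp
next
  case (Suc k)
  have XY: "X * Y \<in> carrier_mat a a" and YX: "Y * X \<in> carrier_mat b b" using X Y by auto
  note pow = pow_carrier_mat[OF XY, of k] pow_carrier_mat[OF YX, of k]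
  have "(X * Y) ^\<^sub>m Suc k * X = (X * Y) ^\<^sub>m k * (X * Y * X)"
    using assoc_mult_mat[OF pow(1) XY X] by simp
  also have "X * Y * X = X * (Y * X)" by (rule assoc_mult_mat[OF X Y X])
  also have "(X * Y) ^\<^sub>m k * (X * (Y * X)) = X * (Y * X) ^\<^sub>m k * (Y * X)"
    using assoc_mult_mat[OF pow(1) X YX] Suc.IH by simp
  also have "\<dots> = X * ((Y * X) ^\<^sub>m k * (Y * X))" by (rule assoc_mult_mat[OF X pow(2) YX])
  finally show ?case by simp
qed

lemma mult_pow_mat_Suc:
  fixes X Y :: "'a :: semiring_1 mat"
  assumes X: "X \<in> carrier_mat a b" and Y: "Y \<in> carrier_mat b a"
  shows "X * (Y * X) ^\<^sub>m k * Y = (X * Y) ^\<^sub>m Suc k"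
proof -
  have XY: "X * Y \<in> carrier_mat a a" using X Y by auto
  show ?thesis
    using assoc_mult_mat[OF pow_carrier_mat[OF XY] X Y] mult_pow_mat_swap[OF X Y] by simp
qed

lemma transpose_pow_symmetric:
  fixes S :: "'a :: comm_semiring_1 mat"
  assumes S: "S \<in> carrier_mat n n" and sym: "S\<^sup>T = S"
  shows "(S ^\<^sub>m k)\<^sup>T = S ^\<^sub>m k"
proof (induction k)
  case (Suc k)
  have "(S ^\<^sub>m Suc k)\<^sup>T = S * S ^\<^sub>m k"
    using transpose_mult[OF pow_carrier_mat[OF S] S] Suc.IH sym by simp
  also have "\<dots> = S ^\<^sub>m k * S"
    using mult_pow_mat_swap[OF S one_carrier_mat, of k] S by simp
  finally show ?case by simp
qed simp

text \<open>The two matrices are transposes of each other, because \<open>A\<^sup>T A\<close> is symmetric and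
  \<open>(A\<^sup>T A)^k A\<^sup>T = A\<^sup>T (A A\<^sup>T)^k\<close>.\<close>

lemma mat_rank_odd_word_symmetric:
  fixes A :: "'a :: field mat"
  assumes A: "A \<in> carrier_mat m n"
  shows "mat_rank (A\<^sup>T * (A * A\<^sup>T) ^\<^sub>m k) = mat_rank (A * (A\<^sup>T * A) ^\<^sub>m k)"
proof -
  have At: "A\<^sup>T \<in> carrier_mat n m" and N: "A\<^sup>T * A \<in> carrier_mat n n" using A by auto
  have sym: "(A\<^sup>T * A)\<^sup>T = A\<^sup>T * A" using transpose_mult[OF At A] by simp
  have "(A * (A\<^sup>T * A) ^\<^sub>m k)\<^sup>T = (A\<^sup>T * A) ^\<^sub>m k * A\<^sup>T"
    using transpose_mult[OF A pow_carrier_mat[OF N]] transpose_pow_symmetric[OF N sym] by simp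
  also have "\<dots> = A\<^sup>T * (A * A\<^sup>T) ^\<^sub>m k" by (rule mult_pow_mat_swap[OF At A])
  finally show ?thesis by (metis mat_rank_transpose)
qed

text \<open>Frobenius' inequality for \<open>A\<^sup>T\<close>, \<open>(A A\<^sup>T)^k\<close>, \<open>A\<close>: both partial products have odd length,
  and their ranks agree.\<close>

lemma odd_word_rank_le:
  fixes A :: "'a :: field mat"
  assumes A: "A \<in> carrier_mat m n"
  shows "2 * mat_rank (A * (A\<^sup>T * A) ^\<^sub>m k)
    \<le> mat_rank ((A * A\<^sup>T) ^\<^sub>m k) + mat_rank ((A\<^sup>T * A) ^\<^sub>m Suc k)"
proof -
  have At: "A\<^sup>T \<in> carrier_mat n m" and N: "A * A\<^sup>T \<in> carrier_mat m m" using A by auto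
  show ?thesis
    using frobenius_rank_inequality[OF At pow_carrier_mat[OF N, of k] A]
      mat_rank_odd_word_symmetric[OF A, of k] mult_pow_mat_swap[OF A At, of k]
      mult_pow_mat_Suc[OF At A, of k]
    by simp
qed

text \<open>Frobenius' inequality for \<open>A\<^sup>T\<close>, \<open>A (A\<^sup>T A)^k\<close>, \<open>A\<^sup>T\<close>: the partial
  products are the two even powers, and the full product \<open>A\<^sup>T (A A\<^sup>T)^(k+1)\<close> has odd length
  again.\<close>

lemma even_word_rank_le:
  fixes A :: "'a :: field mat"
  assumes A: "A \<in> carrier_mat m n"
  shows "mat_rank ((A * A\<^sup>T) ^\<^sub>m Suc k) + mat_rank ((A\<^sup>T * A) ^\<^sub>m Suc k)
    \<le> mat_rank (A * (A\<^sup>T * A) ^\<^sub>m k) + mat_rank (A * (A\<^sup>T * A) ^\<^sub>m Suc k)"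
proof -
  have At: "A\<^sup>T \<in> carrier_mat n m" and N: "A\<^sup>T * A \<in> carrier_mat n n" 
    and M: "A * A\<^sup>T \<in> carrier_mat m m" using A by auto
  have Y: "A * (A\<^sup>T * A) ^\<^sub>m k \<in> carrier_mat m n" 
    using mult_carrier_mat[OF A pow_carrier_mat[OF N]] .
  have XY: "A\<^sup>T * (A * (A\<^sup>T * A) ^\<^sub>m k) = (A\<^sup>T * A) ^\<^sub>m Suc k"
    using mult_pow_mat_swap[OF A At, of k] mult_pow_mat_Suc[OF At A, of k]
      assoc_mult_mat[OF At pow_carrier_mat[OF M, of k] A] by simp
  have XYZ: "A\<^sup>T * (A * (A\<^sup>T * A) ^\<^sub>m k) * A\<^sup>T = A\<^sup>T * (A * A\<^sup>T) ^\<^sub>m Suc k"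
    unfolding assoc_mult_mat[OF At Y At] mult_pow_mat_Suc[OF A At] ..
  show ?thesis
    using frobenius_rank_inequality[OF At Y At, unfolded XYZ]
    unfolding mat_rank_odd_word_symmetric[OF A] XY mult_pow_mat_Suc[OF A At]
    by (simp only: add.commute)
qed

section \<open>Partitions and their common parts\<close>

text \<open>A nilpotent Jordan block of size \<open>x\<close> contributes \<open>min k x\<close> to the dimension of the kernel
  of the \<open>k\<close>-th power, so passing to the next power enlarges the kernel by one dimension for
  each block of size greater than \<open>k\<close>.\<close>

lemma jordan_partition_parts_rank:
  fixes N :: "'a :: field mat"
  assumes N: "N \<in> carrier_mat n n" and p: "has_jordan_partition N p"
  shows "mat_rank (N ^\<^sub>m k) = length (filter (\<lambda>x. k < x) p) + mat_rank (N ^\<^sub>m Suc k)"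
proof -
  obtain n_as where jnf: "jordan_nf N n_as" and ev: "\<forall>(k, a) \<in> set n_as. a = 0"
    and p': "p = rev (sort (map fst n_as))"
    using p unfolding has_jordan_partition_def by blast
  have ker: "kernel_dim (N ^\<^sub>m j) = sum_list (map (min j) p)" for j
  proof -
    have "char_matrix N 0 = N"
      using N unfolding char_matrix_def by (intro eq_matI) auto
    then have "kernel_dim (N ^\<^sub>m j) = sum_list (map (min j) (map fst (filter (\<lambda>(n, e). e = 0) n_as)))"
      using dim_gen_eigenspace[OF jnf, of 0 j] by (simp add: dim_gen_eigenspace_def)
    also have "filter (\<lambda>(n, e). e = 0) n_as = n_as"
      using ev by (intro filter_True) auto
    also have "sum_list (map (min j) (map fst n_as)) = sum_list (map (min j) p)"
      unfolding p' sum_mset_sum_list[symmetric] mset_map mset_rev mset_sort ..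
    finally show ?thesis .
  qed
  have "sum_list (map (min (Suc k)) p) = sum_list (map (min k) p) + length (filter (\<lambda>x. k < x) p)"
    by (induction p) auto
  then show ?thesis
    using rank_nullity[OF pow_carrier_mat[OF N, of k]] rank_nullity[OF pow_carrier_mat[OF N, of "Suc k"]]
      ker[of k] ker[of "Suc k"] by linarith
qed

definition parts_above :: "nat list \<Rightarrow> nat \<Rightarrow> nat" where
  "parts_above p k = length (filter (\<lambda>x. k < x) p)"

text \<open>For a decreasing list the parts greater than \<open>k\<close> form an initial segment; in other words,
  \<open>part\<close> and \<open>parts_above\<close> are conjugate partitions.\<close>

lemma less_part_iff:
  assumes "sorted_wrt (\<ge>) p"
  shows "k < part p i \<longleftrightarrow> i < parts_above p k"
  using assms
proof (induction p arbitrary: i)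
  case Nil
  then show ?case by (simp add: part_def parts_above_def)
next
  case (Cons x p)
  show ?case
  proof (cases "k < x")
    case True
    then show ?thesis using Cons.IH[of "i - 1"] Cons.prems
      by (cases i) (auto simp: part_def parts_above_def)
  next
    case False
    then have "\<forall>y\<in>set (x # p). y \<le> k" using Cons.prems by auto
    then have "parts_above (x # p) k = 0" "part (x # p) i \<le> k"
      unfolding parts_above_def part_def using nth_mem[of i "x # p"]
      by (force simp: filter_empty_conv)+
    then show ?thesis by simp
  qed
qed

lemma part_eq_Suc_iff:
  assumes "sorted_wrt (\<ge>) p"
  shows "part p i = Suc k \<longleftrightarrow> parts_above p (Suc k) \<le> i \<and> i < parts_above p k"
  using less_part_iff[OF assms, of k i] less_part_iff[OF assms, of "Suc k" i] by auto

text \<open>The indices at which a partition takes the value \<open>k+1\<close> form an interval, and the count is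
  the length of the intersection of two such intervals.\<close>

lemma count_gamma_Suc:
  assumes \<alpha>: "sorted_wrt (\<ge>) \<alpha>" and \<beta>: "sorted_wrt (\<ge>) \<beta>"
  shows "count_list (gamma \<alpha> \<beta>) (Suc k)
    = min (parts_above \<alpha> k) (parts_above \<beta> k)
      - max (parts_above \<alpha> (Suc k)) (parts_above \<beta> (Suc k))"
proof -
  have lt: "i < length \<alpha>" if "part \<alpha> i = Suc k" for i
    using that by (auto simp: part_def split: if_splits)
  have "count_list (gamma \<alpha> \<beta>) (Suc k)
      = length (filter (\<lambda>i. part \<alpha> i = Suc k \<and> part \<beta> i = Suc k) [0..<length \<alpha>])"
    by (auto simp: gamma_def count_list_eq_length_filter filter_map o_def intro!: arg_cong[of _ _ length] filter_cong)
  also have "\<dots> = card {i. part \<alpha> i = Suc k \<and> part \<beta> i = Suc k}"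
    using lt by (subst distinct_card[symmetric]) (auto intro!: arg_cong[of _ _ card])
  also have "{i. part \<alpha> i = Suc k \<and> part \<beta> i = Suc k}
      = {max (parts_above \<alpha> (Suc k)) (parts_above \<beta> (Suc k))..<
         min (parts_above \<alpha> k) (parts_above \<beta> k)}"
    by (auto simp: part_eq_Suc_iff[OF \<alpha>] part_eq_Suc_iff[OF \<beta>])
  finally show ?thesis by simp
qed

lemma part_diff_le_1:
  assumes \<alpha>: "sorted_wrt (\<ge>) \<alpha>" and \<beta>: "sorted_wrt (\<ge>) \<beta>"
    and le: "\<And>k. parts_above \<alpha> (Suc k) \<le> parts_above \<beta> k"
  shows "part \<alpha> i \<le> Suc (part \<beta> i)"
proof (rule ccontr)
  assume "\<not> ?thesis"
  then have "i < parts_above \<beta> (part \<beta> i)"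
    using less_part_iff[OF \<alpha>, of "Suc (part \<beta> i)" i] le[of "part \<beta> i"] by simp
  then show False using less_part_iff[OF \<beta>, of "part \<beta> i" i] by simp
qed

lemma sorted_gamma:
  assumes "sorted_wrt (\<ge>) \<alpha>"
  shows "sorted_wrt (\<ge>) (gamma \<alpha> \<beta>)"
proof -
  have "part \<alpha> i \<ge> part \<alpha> j" if "i \<le> j" for i j
    using less_part_iff[OF assms, of "part \<alpha> i" j] less_part_iff[OF assms, of "part \<alpha> i" i] that
    by (meson le_less_trans not_le_imp_less order_less_irrefl)
  moreover have "sorted_wrt (\<le>) (filter P [0..<l])" for P l
    using sorted_wrt_filter sorted_upt by blast
  ultimately show ?thesis
    unfolding gamma_def sorted_wrt_map by (metis (no_types, lifting) sorted_wrt_mono_rel)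
qed

text \<open>Maximality puts a gap of at least 2 on either side of a component, and then, the list being
  decreasing, a component consists of all entries with values in an interval of integers,
  while the integers next to this interval do not occur at all. A component is thereby described
  by multiplicities alone.\<close>

lemma component_of_decreasing_list:
  assumes sorted: "sorted_wrt (\<ge>) p" and comp: "is_component p c"
  shows "length c = (\<Sum>j\<in>{last c..hd c}. count_list p j)"
    and "count_list p (Suc (hd c)) = 0"
    and "last c > 0 \<Longrightarrow> count_list p (last c - 1) = 0"
    and "last c \<le> hd c"
proof -
  from comp obtain xs ys where c: "c \<noteq> []" "small_gaps c" and p: "p = xs @ c @ ys"
    and max: "\<And>xs1 xs2 ys1 ys2. xs = xs1 @ xs2 \<Longrightarrow> ys = ys1 @ ys2 \<Longrightarrow>
      small_gaps (xs2 @ c @ ys1) \<Longrightarrow> xs2 = [] \<and> ys1 = []"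
    unfolding is_component_def by blast
  have sx: "sorted_wrt (\<ge>) xs" and sc: "sorted_wrt (\<ge>) c" and sy: "sorted_wrt (\<ge>) ys"
    and xc: "\<And>x y. x \<in> set xs \<Longrightarrow> y \<in> set c \<Longrightarrow> x \<ge> y"
    and cy: "\<And>x y. x \<in> set c \<Longrightarrow> y \<in> set ys \<Longrightarrow> x \<ge> y"
    using sorted unfolding p by (auto simp: sorted_wrt_append)
  have mem: "hd c \<in> set c" "last c \<in> set c" using c by auto
  have c_range: "last c \<le> z \<and> z \<le> hd c" if z: "z \<in> set c" for z
  proof
    show "z \<le> hd c" using z sc c(1) by (cases c) auto
    have "c = butlast c @ [last c]" using c(1) by simp
    then show "last c \<le> z" using z sc
      by (metis Un_iff empty_iff empty_set order_refl set_append set_ConsD sorted_wrt_append list.set_intros(1))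
  qed
  then show "last c \<le> hd c" using mem by blast
  have above: "Suc (hd c) < x" if x: "x \<in> set xs" for x
  proof -
    from x have ne: "xs \<noteq> []" by auto
    then have xs: "xs = butlast xs @ [last xs]" by simp
    have "\<not> small_gaps (last xs # c)" using max[OF xs, of "[]" ys] by auto
    moreover have "last xs \<ge> hd c" using xc ne mem by simp
    ultimately have "Suc (hd c) < last xs"
      using c unfolding small_gaps_def by (cases c) auto
    moreover have "last xs \<le> x" using x sx xs
      by (metis Un_iff empty_iff empty_set order_refl set_append set_ConsD sorted_wrt_append list.set_intros(1))
    ultimately show ?thesis by simp
  qed
  have below: "Suc y < last c" if y: "y \<in> set ys" for y
  proof -
    from y have ne: "ys \<noteq> []" by auto
    then have ys: "ys = [hd ys] @ tl ys" by simp
    have "\<not> small_gaps (c @ [hd ys])" using max[OF _ ys, of xs "[]"] by auto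
    moreover have "hd ys \<le> last c" using cy ne mem by simp
    ultimately have "Suc (hd ys) < last c"
      using c unfolding small_gaps_def by (auto simp: successively_append_iff)
    moreover have "y \<le> hd ys" using y sy ne by (cases ys) auto
    ultimately show ?thesis by simp
  qed
  have zero: "count_list p z = 0" if "z \<notin> set p" for z
    using that by simp
  show "count_list p (Suc (hd c)) = 0"
    by (rule zero) (use above below c_range mem in \<open>fastforce simp: p\<close>)
  show "count_list p (last c - 1) = 0" if "last c > 0"
    by (rule zero) (use that above below c_range mem in \<open>fastforce simp: p\<close>)
  have "count_list p j = count_list c j" if "j \<in> {last c..hd c}" for j
  proof -
    have "j \<notin> set xs" "j \<notin> set ys" using that above below by fastforce+
    then show ?thesis by (simp add: p)
  qed
  then have "(\<Sum>j\<in>{last c..hd c}. count_list p j) = (\<Sum>j\<in>{last c..hd c}. count_list c j)"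
    by (intro sum.cong) auto
  also have "\<dots> = length c"
    using c_range by (intro sum_count_set) auto
  finally show "length c = (\<Sum>j\<in>{last c..hd c}. count_list p j)" by simp
qed

lemma even_telescoping_sum:
  fixes e h :: "nat \<Rightarrow> nat"
  assumes "a \<le> b"
  shows "even (\<Sum>j=a..b. 2 * e j + h j + h (Suc j)) \<longleftrightarrow> even (h a + h (Suc b))"
  using assms by (induction b rule: dec_induct) auto

text \<open>Here \<open>h k\<close> stands for \<open>min (a k) (b k)\<close> of the introduction. The hypothesis on \<open>1\<close> is what
  makes the value below the component positive, so that its vanishing multiplicity is given
  by the counting formula.\<close>

lemma component_length_even:
  assumes \<alpha>: "sorted_wrt (\<ge>) \<alpha>" and comp: "is_component (gamma \<alpha> \<beta>) c" and one: "1 \<notin> set c"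
    and count: "\<And>k. count_list (gamma \<alpha> \<beta>) (Suc k) = 2 * e k + h k + h (Suc k)"
  shows "even (length c)"
proof -
  note C = component_of_decreasing_list[OF sorted_gamma[OF \<alpha>] comp]
  have ne: "c \<noteq> []" and sub: "set c \<subseteq> set (gamma \<alpha> \<beta>)"
    using comp unfolding is_component_def by auto
  have "last c \<in> set c" using ne by simp
  then have "last c \<noteq> 0" "last c \<noteq> 1"
    using one sub by (auto simp: gamma_def)
  then obtain s where s: "last c = Suc (Suc s)" by (metis One_nat_def not0_implies_Suc)
  obtain t where t: "hd c = Suc t" using C(4) s by (cases "hd c") auto
  have h: "h (Suc s) = 0" "h (Suc t) = 0"
    using C(3) count[of s] C(2) count[of "Suc t"] s t by simp_all
  have "length c = (\<Sum>j=Suc s..t. count_list (gamma \<alpha> \<beta>) (Suc j))"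
    unfolding C(1) s t by (rule sum.shift_bounds_cl_Suc_ivl)
  also have "\<dots> = (\<Sum>j=Suc s..t. 2 * e j + h j + h (Suc j))" by (simp only: count)
  finally show ?thesis using even_telescoping_sum[of "Suc s" t e h] h C(4) s t by simp
qed

section \<open>The partitions of the two products\<close>

theorem corollary1p7:
  fixes m n :: nat and \<alpha> \<beta> :: "nat list"
  assumes "m > 0" and "n > 0"
    and "is_partition_of \<alpha> m" and "is_partition_of \<beta> n"
    and "\<exists>A :: 'k :: field mat. A \<in> carrier_mat m n \<and>
           nilpotent_mat (A * transpose_mat A) \<and>
           has_jordan_partition (transpose_mat A * A) \<beta> \<and>
           has_jordan_partition (A * transpose_mat A) \<alpha>"
  shows "(\<forall>i. \<bar>int (part \<alpha> i) - int (part \<beta> i)\<bar> \<le> 1) \<and>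
         (\<forall>c. is_component (gamma \<alpha> \<beta>) c \<and> 1 \<notin> set c \<longrightarrow> even (length c))"
proof -
  have \<alpha>: "sorted_wrt (\<ge>) \<alpha>" and \<beta>: "sorted_wrt (\<ge>) \<beta>"
    using assms(3,4) by (auto simp: is_partition_of_def)
  from assms(5) obtain A :: "'k mat" where A: "A \<in> carrier_mat m n"
    and jordan: "has_jordan_partition (A\<^sup>T * A) \<beta>" "has_jordan_partition (A * A\<^sup>T) \<alpha>"
    by blast
  have At: "A\<^sup>T \<in> carrier_mat n m" and M: "A * A\<^sup>T \<in> carrier_mat m m"
    and N: "A\<^sup>T * A \<in> carrier_mat n n" using A by auto
  define p where "p k = mat_rank ((A * A\<^sup>T) ^\<^sub>m k)" for k
  define p' where "p' k = mat_rank ((A\<^sup>T * A) ^\<^sub>m k)" for k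
  define q where "q k = mat_rank (A * (A\<^sup>T * A) ^\<^sub>m k)" for k
  have p: "p k = parts_above \<alpha> k + p (Suc k)" for k
    unfolding p_def parts_above_def by (rule jordan_partition_parts_rank[OF M jordan(2)])
  have p': "p' k = parts_above \<beta> k + p' (Suc k)" for k
    unfolding p'_def parts_above_def by (rule jordan_partition_parts_rank[OF N jordan(1)])
  have ineq1: "2 * q k \<le> p k + p' (Suc k)" for k
    unfolding p_def p'_def q_def by (rule odd_word_rank_le[OF A])
  have ineq2: "2 * q k \<le> p' k + p (Suc k)" for k
    using odd_word_rank_le[OF At, of k] mat_rank_odd_word_symmetric[OF A, of k]
    unfolding p_def p'_def q_def by simp
  have ineq3: "p (Suc k) + p' (Suc k) \<le> q k + q (Suc k)" for k
    unfolding p_def p'_def q_def by (rule even_word_rank_le[OF A])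
  define a b e where "a k = p k + p' (Suc k) - 2 * q k" and "b k = p' k + p (Suc k) - 2 * q k"
    and "e k = q k + q (Suc k) - p (Suc k) - p' (Suc k)" for k
  \<comment> \<open>The multiplicities of the parts, read off from the chains behind \<open>a\<close>, \<open>b\<close> and \<open>e\<close>.\<close>
  have split:
    "parts_above \<alpha> k = 2 * e k + a k + b (Suc k) + parts_above \<alpha> (Suc k)"
    "parts_above \<beta> k = 2 * e k + b k + a (Suc k) + parts_above \<beta> (Suc k)"
    "parts_above \<alpha> k + b k = parts_above \<beta> k + a k" for k
    using p[of k] p[of "Suc k"] p'[of k] p'[of "Suc k"] ineq1[of k] ineq1[of "Suc k"]
      ineq2[of k] ineq2[of "Suc k"] ineq3[of k]
    unfolding a_def b_def e_def by linarith+
  have count: "count_list (gamma \<alpha> \<beta>) (Suc k)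
      = 2 * e k + min (a k) (b k) + min (a (Suc k)) (b (Suc k))" for k
    using split(1)[of k] split(2)[of k] split(3)[of "Suc k"]
    unfolding count_gamma_Suc[OF \<alpha> \<beta>]
    by (cases "a k \<le> b k"; cases "a (Suc k) \<le> b (Suc k)") linarith+
  have le: "parts_above \<alpha> (Suc k) \<le> parts_above \<beta> k" "parts_above \<beta> (Suc k) \<le> parts_above \<alpha> k" for k
    using split(1,2)[of k] split(3)[of "Suc k"] by linarith+
  have "\<bar>int (part \<alpha> i) - int (part \<beta> i)\<bar> \<le> 1" for i
    using part_diff_le_1[OF \<alpha> \<beta> le(1), of i] part_diff_le_1[OF \<beta> \<alpha> le(2), of i] by simp
  moreover have "even (length c)" if "is_component (gamma \<alpha> \<beta>) c" "1 \<notin> set c" for c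
    by (rule component_length_even[where h = "\<lambda>k. min (a k) (b k)", OF \<alpha> that count])
  ultimately show ?thesis by blast
qed

end
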